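(* Let $\epsilon>0$ and let $\alpha,\beta\in[0,1]$ satisfy $$\min\{\alpha,\beta\}\ge\frac12.$$ Let $\rho\in H^1([0,1])$ be the unique weak solution of $$-\epsilon\,\partial_{xx}\rho+\partial_x(\rho(1-\rho))=0\quad\text{in }(0,1),$$ with boundary conditions $$\epsilon\,\partial_x\rho=(1-\rho)(\rho-\alpha)\ \text{ at }x=0,\qquad \epsilon\,\partial_x\rho=\rho(1-\rho-\beta)\ \text{ at }x=1.$$ Then $$\int_0^1\Big(\rho-\frac12\Big)^2dx\le\epsilon\,|1-\alpha-\beta|,$$ and furthermore the (constant) flux $j=-\epsilon\,\partial_x\rho+\rho(1-\rho)$ satisfies $j\ge\frac14$.
   Context: A weak solution is a function $\rho\in H^1((0,1))$ such that for all $\varphi\in H^1((0,1))$ $$\int_0^1\big(\epsilon\,\partial_x\rho-\rho(1-\rho)\big)\partial_x\varphi\,dx-\alpha(1-\rho(0))\varphi(0)+\beta\rho(1)\varphi(1)=0.$$ The weak solution exists and is unique for these parameters. The flux $j$ is constant in $x$ and $j=\alpha(1-\rho(0))=\beta\rho(1)$. *)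

theory Defs
  imports "HOL-Analysis.Analysis"
begin

abbreviation unit_ioo :: "real set" where
  "unit_ioo \<equiv> {0<..<1}"

definition square_integrable :: "(real \<Rightarrow> real) \<Rightarrow> bool" where
  "square_integrable f \<longleftrightarrow>
     set_borel_measurable lebesgue unit_ioo f \<and>
     set_integrable lebesgue unit_ioo (\<lambda>x. (f x)\<^sup>2)"

definition test_function :: "(real \<Rightarrow> real) \<Rightarrow> bool" where
  "test_function \<phi> \<longleftrightarrow>
     (\<forall>n x. (deriv ^^ n) \<phi> differentiable (at x)) \<and>
     compact (closure {x. \<phi> x \<noteq> 0}) \<and> closure {x. \<phi> x \<noteq> 0} \<subseteq> unit_ioo"

definition weak_derivative :: "(real \<Rightarrow> real) \<Rightarrow> (real \<Rightarrow> real) \<Rightarrow> bool" where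
  "weak_derivative u v \<longleftrightarrow>
     (\<forall>\<phi>. test_function \<phi> \<longrightarrow>
        (LINT x:unit_ioo|lebesgue. u x * deriv \<phi> x) =
        - (LINT x:unit_ioo|lebesgue. v x * \<phi> x))"

text \<open>
  Every class in the Sobolev space of the unit interval has exactly one representative
  that is continuous up to the boundary, and the boundary values of the class are the values of
  that representative. The continuity clause below selects it, so that \<open>u 0\<close> and \<open>u 1\<close> are
  the traces; values outside the closed unit interval play no role.
\<close>

definition H1 :: "(real \<Rightarrow> real) set" where
  "H1 = {u. continuous_on {0..1} u \<and> square_integrable u \<and>
            (\<exists>v. square_integrable v \<and> weak_derivative u v)}"

text \<open>
  Weak derivatives are unique up to null sets; \<open>wderiv u\<close> is an arbitrary representative and is
  only used under integrals and almost everywhere.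
\<close>

definition wderiv :: "(real \<Rightarrow> real) \<Rightarrow> real \<Rightarrow> real" where
  "wderiv u = (SOME v. square_integrable v \<and> weak_derivative u v)"

definition weak_solution :: "real \<Rightarrow> real \<Rightarrow> real \<Rightarrow> (real \<Rightarrow> real) \<Rightarrow> bool" where
  "weak_solution \<epsilon> \<alpha> \<beta> \<rho> \<longleftrightarrow>
     \<rho> \<in> H1 \<and>
     (\<forall>\<phi>\<in>H1.
        (LINT x:unit_ioo|lebesgue. (\<epsilon> * wderiv \<rho> x - \<rho> x * (1 - \<rho> x)) * wderiv \<phi> x)
          - \<alpha> * (1 - \<rho> 0) * \<phi> 0 + \<beta> * \<rho> 1 * \<phi> 1 = 0)"

definition flux :: "real \<Rightarrow> (real \<Rightarrow> real) \<Rightarrow> real \<Rightarrow> real" where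
  "flux \<epsilon> \<rho> x = - \<epsilon> * wderiv \<rho> x + \<rho> x * (1 - \<rho> x)"

end

theory Submission imports Defs begin

text \<open>
  Testing the weak form with primitives of bump functions shows, by the fundamental lemma of the
  calculus of variations, that the flux is almost everywhere a constant
  \<open>j = \<beta> \<rho>(1) = \<alpha> (1 - \<rho>(0))\<close>. Hence the weak derivative of \<open>\<rho>\<close> has a continuous representative and \<open>\<rho>\<close>
  solves the ODE \<open>\<epsilon> \<rho>' = \<rho> (1 - \<rho>) - j = 1/4 - j - (\<rho> - 1/2)\<^sup>2\<close> classically on the closed interval.
  If \<open>j < 1/4\<close>, the boundary conditions and \<open>\<alpha>, \<beta> \<ge> 1/2\<close> give \<open>\<rho>(0) > 1/2 > \<rho>(1)\<close>, whereas the ODE forces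
  \<open>\<rho>\<close> to increase whenever it takes the value \<open>1/2\<close>. Integrating the ODE with \<open>j \<ge> 1/4\<close> bounds the integral of
  \<open>(\<rho> - 1/2)\<^sup>2\<close> by \<open>\<epsilon> (\<rho>(0) - \<rho>(1))\<close>, and \<open>\<rho>(0) \<le> \<alpha>\<close> and \<open>\<rho>(1) \<ge> 1 - \<beta>\<close> since \<open>a + 1/(4 a) \<ge> 1\<close>.
\<close>

section \<open>Smooth bump functions\<close>

definition smooth :: "(real \<Rightarrow> real) \<Rightarrow> bool" where
  "smooth f \<longleftrightarrow> (\<forall>n x. (deriv ^^ n) f differentiable (at x))"

text \<open>Replaces formulas for n-th derivatives: smoothness is a greatest fixed point, so each
  closure property below reduces to finding a family of differentiable functions that is invariant
  under \<open>deriv\<close>.\<close>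

lemma smooth_coinduct:
  assumes "f \<in> S"
    and "\<And>g x. g \<in> S \<Longrightarrow> g differentiable (at x)"
    and "\<And>g. g \<in> S \<Longrightarrow> deriv g \<in> S"
  shows "smooth f"
proof -
  have "(deriv ^^ n) f \<in> S" for n
    by (induction n) (auto simp: assms)
  then show ?thesis
    using assms(2) by (auto simp: smooth_def)
qed

lemma smooth_differentiable: "smooth f \<Longrightarrow> f differentiable (at x)"
  unfolding smooth_def by (metis funpow_0)

lemma smooth_has_deriv: "smooth f \<Longrightarrow> (f has_real_derivative deriv f x) (at x)"
  using smooth_differentiable DERIV_deriv_iff_real_differentiable by blast

lemma smooth_deriv: "smooth f \<Longrightarrow> smooth (deriv f)"
  unfolding smooth_def by (metis funpow_Suc_right o_apply)

lemma smooth_continuous_on: "smooth f \<Longrightarrow> continuous_on A f"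
  by (meson DERIV_isCont continuous_at_imp_continuous_on smooth_has_deriv)

lemma smooth_primitive:
  assumes "\<And>x. (F has_real_derivative f x) (at x)" and "smooth f"
  shows "smooth F"
proof (rule smooth_coinduct[where S = "insert F (Collect smooth)"])
  have "deriv F = f"
    using assms(1) by (auto intro: DERIV_imp_deriv)
  then show "deriv g \<in> insert F (Collect smooth)" if "g \<in> insert F (Collect smooth)" for g
    using that assms(2) smooth_deriv by auto
qed (use assms(1) smooth_differentiable real_differentiable_def in auto)

text \<open>The outer factor \<open>c\<close> absorbs the constant \<open>a\<close> that the chain
  rule produces in each differentiation, which makes the family invariant under
  \<open>deriv\<close>.\<close>

lemma smooth_affine:
  assumes "smooth f"
  shows "smooth (\<lambda>x. c * f (a * x + b))"
proof (rule smooth_coinduct[where S = "{\<lambda>x. c * f (a * x + b) | c f. smooth f}"])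
  have der: "((\<lambda>x. c * f (a * x + b)) has_real_derivative (c * a) * deriv f (a * x + b)) (at x)"
    if "smooth f" for c f x
  proof -
    have "((\<lambda>x. a * x + b) has_real_derivative a) (at x)"
      by (auto intro!: derivative_eq_intros)
    from DERIV_cmult[OF DERIV_chain2[OF smooth_has_deriv[OF that] this]] show ?thesis
      by (rule DERIV_cong) (simp add: mult_ac)
  qed
  fix g assume "g \<in> {\<lambda>x. c * f (a * x + b) | c f. smooth f}"
  then obtain c f where g: "g = (\<lambda>x. c * f (a * x + b))" and f: "smooth f" by blast
  show "g differentiable (at x)" for x
    using der[OF f] g real_differentiable_def by blast
  have "deriv g = (\<lambda>x. (c * a) * deriv f (a * x + b))"
    unfolding g using der[OF f] by (auto intro: DERIV_imp_deriv)
  then show "deriv g \<in> {\<lambda>x. c * f (a * x + b) | c f. smooth f}"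
    using smooth_deriv[OF f] by blast
qed (use assms in blast)

text \<open>By the Leibniz rule the derivative of a product is a sum of two products. Closing the
  products under sums therefore gives a family invariant under \<open>deriv\<close>.\<close>

inductive_set products :: "(real \<Rightarrow> real) set" where
  product: "smooth f \<Longrightarrow> smooth g \<Longrightarrow> (\<lambda>x. f x * g x) \<in> products"
| sum: "f \<in> products \<Longrightarrow> g \<in> products \<Longrightarrow> (\<lambda>x. f x + g x) \<in> products"

lemma products_smooth:
  assumes "h \<in> products"
  shows "smooth h"
proof (rule smooth_coinduct[where S = products])
  have der: "\<exists>h' \<in> products. \<forall>x. (h has_real_derivative h' x) (at x)" if "h \<in> products" for h
    using that
  proof induction
    case (product f g)
    have "((\<lambda>x. f x * g x) has_real_derivative deriv f x * g x + f x * deriv g x) (at x)" for x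
      using DERIV_mult'[OF smooth_has_deriv[OF product(1)] smooth_has_deriv[OF product(2)]]
      by (simp add: add.commute)
    moreover have "(\<lambda>x. deriv f x * g x + f x * deriv g x) \<in> products"
      using product by (intro products.intros smooth_deriv)
    ultimately show ?case by (intro bexI) auto
  next
    case (sum f g)
    then obtain f' g' where "f' \<in> products" "g' \<in> products"
      and "\<And>x. (f has_real_derivative f' x) (at x)" "\<And>x. (g has_real_derivative g' x) (at x)"
      by blast
    then show ?case
      by (intro bexI[where x = "\<lambda>x. f' x + g' x"]) (auto intro: products.sum DERIV_add)
  qed
  show "g differentiable (at x)" if "g \<in> products" for g x
    using der[OF that] real_differentiable_def by blast
  show "deriv g \<in> products" if g: "g \<in> products" for g
  proof -
    obtain h' where h': "h' \<in> products" "\<And>x. (g has_real_derivative h' x) (at x)"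
      using der[OF g] by blast
    have "deriv g = h'" using h'(2) by (auto intro: DERIV_imp_deriv)
    with h'(1) show ?thesis by simp
  qed
qed (fact assms)

lemma smooth_mult: "smooth f \<Longrightarrow> smooth g \<Longrightarrow> smooth (\<lambda>x. f x * g x)"
  using products_smooth[OF products.product] .

lemma smooth_const: "smooth (\<lambda>x. c)"
proof (rule smooth_coinduct[where S = "range (\<lambda>c x. c)"])
  fix g :: "real \<Rightarrow> real" assume "g \<in> range (\<lambda>c x. c)"
  then obtain c where g: "g = (\<lambda>x. c)" by blast
  show "deriv g \<in> range (\<lambda>c x. c)" by (auto simp: g)
qed auto

lemma smooth_add:
  assumes "smooth f" "smooth g" shows "smooth (\<lambda>x. f x + g x)"
proof -
  have "(\<lambda>x. f x * 1 + g x * 1) \<in> products"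
    using assms by (intro products.sum products.product smooth_const)
  then show ?thesis using products_smooth by simp
qed

lemma smooth_cmult: "smooth f \<Longrightarrow> smooth (\<lambda>x. c * f x)"
  by (intro smooth_mult smooth_const)

section \<open>A flat function and compactly supported bumps\<close>

definition flat :: "real \<Rightarrow> real" where
  "flat x = (if x > 0 then exp (- (1 / x)) else 0)"

lemma tendsto_poly_div_exp_0: "((\<lambda>x. poly p x / exp x) \<longlongrightarrow> (0::real)) at_top"
proof -
  have "((\<lambda>x. \<Sum>i\<le>degree p. coeff p i * (x ^ i / exp x)) \<longlongrightarrow> (\<Sum>i\<le>degree p. coeff p i * 0)) at_top"
    by (intro tendsto_intros tendsto_power_div_exp_0)
  then show ?thesis
    by (simp add: poly_altdef sum_divide_distrib)
qed

text \<open>The invariant family consists of the functions p(1/x) exp(-1/x) for x > 0, extended by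
  zero, with p a polynomial. Exponential decay beats every polynomial in 1/x, so all of them are
  differentiable at the origin with derivative 0.\<close>

lemma smooth_flat: "smooth flat"
proof (rule smooth_coinduct)
  define G where "G p = (\<lambda>x::real. if x > 0 then poly p (1 / x) * exp (- (1 / x)) else 0)" for p
  \<comment> \<open>By the product and chain rules, differentiating p(1/x) exp(-1/x) multiplies p -
    p' by the square of 1/x; \<open>[:0, 0, 1:]\<close> is the monomial of degree 2.\<close>
  define D where "D p = [:0, 0, 1:] * (p - pderiv p)" for p :: "real poly"
  have "flat = G 1" by (auto simp: flat_def G_def fun_eq_iff)
  then show "flat \<in> range G" by simp
  have lim0: "((\<lambda>x. poly p (1 / x) * exp (- (1 / x))) \<longlongrightarrow> 0) (at_right 0)" for p :: "real poly"
    using filterlim_compose[OF tendsto_poly_div_exp_0 filterlim_inverse_at_top_right]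
    by (simp add: exp_minus divide_inverse)
  have der: "(G p has_real_derivative G (D p) x) (at x)" for p x
  proof (cases x "0::real" rule: linorder_cases)
    case less
    have "(G p has_real_derivative 0) (at x)"
      by (rule has_field_derivative_transform_within_open[where f = "\<lambda>_. 0" and S = "{..<0}"])
        (use less in \<open>auto simp: G_def\<close>)
    then show ?thesis using less by (simp add: G_def)
  next
    case greater
    have "((\<lambda>x. poly p (1 / x) * exp (- (1 / x))) has_real_derivative
        poly (D p) (1 / x) * exp (- (1 / x))) (at x)"
    proof -
      have inv: "((\<lambda>x. 1 / x) has_real_derivative - ((1 / x)\<^sup>2)) (at x)"
        using greater by (auto intro!: derivative_eq_intros simp: power2_eq_square)
      have "((\<lambda>x. poly p (1 / x)) has_real_derivative poly (pderiv p) (1 / x) * - ((1 / x)\<^sup>2)) (at x)"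
        by (rule DERIV_chain2[OF poly_DERIV inv])
      moreover have "((\<lambda>x. exp (- (1 / x))) has_real_derivative exp (- (1 / x)) * - (- ((1 / x)\<^sup>2))) (at x)"
        by (rule DERIV_chain2[OF DERIV_exp DERIV_minus[OF inv]])
      ultimately have "((\<lambda>x. poly p (1 / x) * exp (- (1 / x))) has_real_derivative
          poly p (1 / x) * (exp (- (1 / x)) * - (- ((1 / x)\<^sup>2)))
          + poly (pderiv p) (1 / x) * - ((1 / x)\<^sup>2) * exp (- (1 / x))) (at x)"
        by (rule DERIV_mult')
      then show ?thesis
        by (rule DERIV_cong) (simp add: D_def algebra_simps power2_eq_square)
    qed
    then have "(G p has_real_derivative poly (D p) (1 / x) * exp (- (1 / x))) (at x)"
      by (rule has_field_derivative_transform_within_open[where S = "{0<..}"])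
        (use greater in \<open>auto simp: G_def\<close>)
    then show ?thesis using greater by (simp add: G_def)
  next
    case equal
    \<comment> \<open>Dividing by y multiplies the polynomial in 1/y by its variable, so the right
      difference quotient belongs to the polynomial \<open>pCons 0 p\<close> and \<open>lim0\<close>
      applies. The left difference quotient is identically zero.\<close>
    have "((\<lambda>y. (G p y - G p 0) / (y - 0)) \<longlongrightarrow> 0) (at_right 0)"
      by (rule Lim_transform_eventually[OF lim0[of "pCons 0 p"]])
        (auto simp: G_def eventually_at_right_field intro!: exI[of _ 1])
    moreover have "((\<lambda>y. (G p y - G p 0) / (y - 0)) \<longlongrightarrow> 0) (at_left 0)"
      by (rule Lim_transform_eventually[OF tendsto_const])
        (auto simp: G_def eventually_at_left_field intro!: exI[of _ "-1"])
    ultimately have "(G p has_real_derivative 0) (at 0)"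
      unfolding has_field_derivative_iff filterlim_at_split by blast
    then show ?thesis using equal by (simp add: G_def)
  qed
  fix g assume "g \<in> range G"
  then obtain p where g: "g = G p" by blast
  show "g differentiable (at x)" for x
    using der g real_differentiable_def by blast
  have "deriv g = G (D p)"
    unfolding g using der by (auto intro: DERIV_imp_deriv)
  then show "deriv g \<in> range G" by simp
qed

lemma flat_bounds: "0 \<le> flat x" "flat x \<le> 1"
  by (auto simp: flat_def)

text \<open>The margin \<delta> plays two roles: the function vanishes outside the interval shrunk
  by \<delta> on both sides, and the arguments of \<open>flat\<close> are measured in units of
  \<delta>, so that at a fixed interior point they tend to infinity with \<open>n\<close>. The
  summand 3 keeps \<delta> at most a third of the length, so the midpoint always stays inside the
  shrunk interval.\<close>

definition bump :: "real \<Rightarrow> real \<Rightarrow> nat \<Rightarrow> real \<Rightarrow> real" where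
  "bump lo hi n x = (let \<delta> = (hi - lo) / (real n + 3)
     in flat ((x - (lo + \<delta>)) / \<delta>) * flat ((hi - \<delta> - x) / \<delta>))"

lemma smooth_bump: "smooth (bump lo hi n)"
proof -
  define \<delta> where "\<delta> = (hi - lo) / (real n + 3)"
  have "smooth (\<lambda>x. (1 * flat (1 / \<delta> * x + - (lo + \<delta>) / \<delta>)) * (1 * flat (- 1 / \<delta> * x + (hi - \<delta>) / \<delta>)))"
    by (intro smooth_mult smooth_affine smooth_flat)
  moreover have "(\<lambda>x. (1 * flat (1 / \<delta> * x + - (lo + \<delta>) / \<delta>)) * (1 * flat (- 1 / \<delta> * x + (hi - \<delta>) / \<delta>))) = bump lo hi n"
    unfolding bump_def \<delta>_def[symmetric] Let_def
    by (rule ext, simp, intro arg_cong2[where f = "(*)"] arg_cong[where f = flat])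
      (simp_all add: diff_divide_distrib add_divide_distrib)
  ultimately show ?thesis by simp
qed

lemma bump_bounds: "0 \<le> bump lo hi n x" "bump lo hi n x \<le> 1"
  by (auto simp: bump_def Let_def flat_bounds mult_le_one)

lemma bump_eq_0:
  assumes "lo < hi" "x \<notin> {lo + (hi - lo) / (real n + 3)..hi - (hi - lo) / (real n + 3)}"
  shows "bump lo hi n x = 0"
proof -
  define \<delta> where "\<delta> = (hi - lo) / (real n + 3)"
  have "\<delta> > 0" using assms by (simp add: \<delta>_def)
  with assms(2) show ?thesis
    unfolding bump_def \<delta>_def[symmetric] by (auto simp: flat_def field_simps)
qed

lemma bump_pos:
  assumes "lo < hi"
  shows "bump lo hi n ((lo + hi) / 2) > 0"
proof -
  define \<delta> where "\<delta> = (hi - lo) / (real n + 3)"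
  have "\<delta> > 0" using assms by (simp add: \<delta>_def)
  moreover have "\<delta> * 3 \<le> hi - lo"
    using mult_left_mono[of 3 "real n + 3" "hi - lo"] assms
    by (simp add: \<delta>_def pos_divide_le_eq)
  ultimately show ?thesis
    unfolding bump_def \<delta>_def[symmetric] Let_def by (simp add: flat_def field_simps)
qed

lemma bump_tendsto_indicator:
  assumes "lo < hi"
  shows "(\<lambda>n. bump lo hi n x) \<longlonglongrightarrow> indicator {lo<..<hi} x"
proof (cases "x \<in> {lo<..<hi}")
  case False
  have "bump lo hi n x = 0" for n
  proof (rule bump_eq_0[OF assms])
    have "(hi - lo) / (real n + 3) > 0" using assms by simp
    then show "x \<notin> {lo + (hi - lo) / (real n + 3)..hi - (hi - lo) / (real n + 3)}"
      using False by auto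
  qed
  then show ?thesis using False by simp
next
  case True
  define \<delta> where "\<delta> n = (hi - lo) / (real n + 3)" for n
  have \<delta>_pos: "\<delta> n > 0" for n using assms by (simp add: \<delta>_def)
  have \<delta>: "\<delta> \<longlonglongrightarrow> 0" unfolding \<delta>_def
    by (rule real_tendsto_divide_at_top[OF tendsto_const])
      (subst add.commute, rule filterlim_tendsto_add_at_top[OF tendsto_const filterlim_real_sequentially])
  \<comment> \<open>As soon as \<delta> is below z, the value is exp(-\<delta>/(z - \<delta>)),
    whose exponent tends to 0. It is used with z the distance of x to either endpoint.\<close>
  have flat_lim: "(\<lambda>n. flat ((z - \<delta> n) / \<delta> n)) \<longlonglongrightarrow> 1" if "z > 0" for z
  proof (rule Lim_transform_eventually)
    show "(\<lambda>n. exp (- (\<delta> n / (z - \<delta> n)))) \<longlonglongrightarrow> 1"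
      using that by (auto intro!: tendsto_eq_intros \<delta>)
    have "eventually (\<lambda>n. \<delta> n < z) sequentially"
      using \<delta> that by (rule order_tendstoD)
    then show "eventually (\<lambda>n. exp (- (\<delta> n / (z - \<delta> n))) = flat ((z - \<delta> n) / \<delta> n)) sequentially"
      by eventually_elim (use \<delta>_pos in \<open>auto simp: flat_def\<close>)
  qed
  have "(\<lambda>n. flat ((x - lo - \<delta> n) / \<delta> n) * flat ((hi - x - \<delta> n) / \<delta> n)) \<longlonglongrightarrow> 1 * 1"
    using True by (intro tendsto_mult flat_lim) auto
  moreover have "bump lo hi n x = flat ((x - lo - \<delta> n) / \<delta> n) * flat ((hi - x - \<delta> n) / \<delta> n)" for n
    unfolding bump_def \<delta>_def[symmetric] Let_def by (simp only: diff_diff_eq add.commute)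
  ultimately show ?thesis
    using True by simp
qed

section \<open>Test functions and intervals containing their support\<close>

lemma test_functionI:
  assumes "smooth \<phi>" and "0 < p" "q < 1" and "\<And>x. x \<notin> {p..q} \<Longrightarrow> \<phi> x = 0"
  shows "test_function \<phi>"
proof -
  have "closure {x. \<phi> x \<noteq> 0} \<subseteq> {p..q}"
    using assms(4) by (intro closure_minimal subsetI) (blast, simp)
  moreover from this have "compact (closure {x. \<phi> x \<noteq> 0})"
    using bounded_subset[OF bounded_closed_interval] by (auto simp: compact_eq_bounded_closed)
  ultimately show ?thesis
    using assms by (auto simp: test_function_def smooth_def)
qed

lemma test_functionE:
  assumes "test_function \<phi>"
  obtains p q where "smooth \<phi>" "0 < p" "p < q" "q < 1" "\<And>x. x \<notin> {p..q} \<Longrightarrow> \<phi> x = 0"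
proof -
  \<comment> \<open>The two extra points keep K nonempty even for the zero function and force its
    minimum to lie strictly below its maximum.\<close>
  define K where "K = insert (1/3) (insert (1/2) (closure {x. \<phi> x \<noteq> 0}))"
  have K: "compact K" "K \<subseteq> {0<..<1}" "K \<noteq> {}" "1/3 \<in> K" "1/2 \<in> K"
    using assms by (auto simp: K_def test_function_def)
  obtain p q where pq: "p \<in> K" "\<And>t. t \<in> K \<Longrightarrow> p \<le> t" "q \<in> K" "\<And>t. t \<in> K \<Longrightarrow> t \<le> q"
    using compact_attains_inf[OF K(1,3)] compact_attains_sup[OF K(1,3)] by metis
  have "\<phi> x = 0" if "x \<notin> {p..q}" for x
  proof (rule ccontr)
    assume "\<phi> x \<noteq> 0"
    then have "x \<in> K" by (auto simp: K_def intro: subsetD[OF closure_subset])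
    then show False using that pq by auto
  qed
  moreover have "p < q" using pq(2)[OF K(4)] pq(4)[OF K(5)] by linarith
  moreover have "smooth \<phi>" using assms by (auto simp: test_function_def smooth_def)
  moreover have "0 < p" "q < 1" using K(2) pq(1,3) by auto
  ultimately show ?thesis using that by blast
qed

lemma test_function_bump:
  assumes "0 \<le> lo" "lo < hi" "hi \<le> 1"
  shows "test_function (bump lo hi n)"
proof (rule test_functionI)
  have "(hi - lo) / (real n + 3) > 0" using assms by simp
  then show "0 < lo + (hi - lo) / (real n + 3)" "hi - (hi - lo) / (real n + 3) < 1"
    using assms by linarith+
  show "bump lo hi n x = 0"
    if "x \<notin> {lo + (hi - lo) / (real n + 3)..hi - (hi - lo) / (real n + 3)}" for x
    using bump_eq_0[OF assms(2) that] .
qed (rule smooth_bump)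

section \<open>The fundamental lemma of the calculus of variations\<close>

lemma square_integrable_imp_set_integrable:
  assumes "square_integrable f"
  shows "set_integrable lebesgue unit_ioo f"
proof (rule set_integrable_bound)
  have "set_integrable lebesgue unit_ioo (\<lambda>x. 1::real)"
    by (rule absolutely_integrable_on_const) (simp add: lmeasurable_iff_integrable)
  then show "set_integrable lebesgue unit_ioo (\<lambda>x. 1 + (f x)\<^sup>2)"
    using assms by (intro set_integral_add) (auto simp: square_integrable_def)
  show "set_borel_measurable lebesgue unit_ioo f"
    using assms by (simp add: square_integrable_def)
  \<comment> \<open>On an interval of finite length this bound makes every square integrable
    function integrable; it follows by expanding the square of |f x| - 1/2.\<close>
  have "\<bar>f x\<bar> \<le> 1 + (f x)\<^sup>2" for x
    using zero_le_power2[of "\<bar>f x\<bar> - 1 / 2"] by (simp add: power2_diff power_divide)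
  then show "AE x in lebesgue. x \<in> unit_ioo \<longrightarrow> norm (f x) \<le> norm (1 + (f x)\<^sup>2)"
    by (intro AE_I2) (simp add: order_trans[OF _ abs_ge_self])
qed

lemma continuous_set_integrable:
  fixes f :: "real \<Rightarrow> real"
  assumes "continuous_on {0..1} f"
  shows "set_integrable lebesgue unit_ioo f"
  by (rule set_integrable_subset[OF absolutely_integrable_continuous_real[OF assms]]) auto

lemma set_integrable_mult_continuous:
  fixes f g :: "real \<Rightarrow> real"
  assumes f: "set_integrable lebesgue unit_ioo f" and g: "continuous_on {0..1} g"
  shows "set_integrable lebesgue unit_ioo (\<lambda>x. f x * g x)"
proof -
  obtain B where B: "\<And>x. x \<in> {0..1} \<Longrightarrow> \<bar>g x\<bar> \<le> B"
    using compact_imp_bounded[OF compact_continuous_image[OF g compact_Icc]]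
    unfolding bounded_iff by fastforce
  show ?thesis
  proof (rule set_integrable_bound)
    show "set_integrable lebesgue unit_ioo (\<lambda>x. B * f x)"
      using f by (rule set_integrable_mult_right)
    \<comment> \<open>Nothing is known about \<open>g\<close> outside the closed unit interval, so
      measurability is derived from the two truncated factors; the product of the two indicators is
      again the indicator.\<close>
    have "(\<lambda>x. (indicator unit_ioo x *\<^sub>R f x) * (indicator unit_ioo x *\<^sub>R g x))
        \<in> borel_measurable lebesgue"
      using f continuous_set_integrable[OF g] unfolding set_integrable_def
      by (intro borel_measurable_times) auto
    then show "set_borel_measurable lebesgue unit_ioo (\<lambda>x. f x * g x)"
      unfolding set_borel_measurable_def
      by (rule back_subst[of "\<lambda>h. h \<in> borel_measurable lebesgue"]) (auto simp: indicator_def)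
    have "\<bar>f x * g x\<bar> \<le> \<bar>B * f x\<bar>" if "x \<in> unit_ioo" for x
      using mult_left_mono[OF order_trans[OF B[of x] abs_ge_self], of "\<bar>f x\<bar>"] that
      by (simp add: abs_mult mult.commute)
    then show "AE x in lebesgue. x \<in> unit_ioo \<longrightarrow> norm (f x * g x) \<le> norm (B * f x)"
      by (intro AE_I2) simp
  qed
qed

section \<open>Functions all of whose test integrals vanish\<close>

lemma AE_zero_of_lessThan_integrals:
  fixes g :: "real \<Rightarrow> real"
  assumes g: "integrable lborel g"
    and lessThan: "\<And>t. (LINT x:{..<t}|lborel. g x) = 0" and total: "(LINT x|lborel. g x) = 0"
  shows "AE x in lborel. g x = 0"
proof (rule sigma_finite_measure.density_zero[OF lborel.sigma_finite_measure_axioms g])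
  have int: "set_integrable lborel A g" if "A \<in> sets borel" for A
    unfolding set_integrable_def using g that by (intro integrable_mult_indicator) auto
  \<comment> \<open>Pi-lambda argument: the open half-lines are an intersection-stable generator of
    the Borel sets, and the sets over which \<open>g\<close> integrates to zero are closed under
    complements, by \<open>total\<close>, and under countable disjoint unions.\<close>
  have borel: "sets (borel :: real measure) = sigma_sets UNIV (range lessThan)"
    by (simp add: borel_Iio)
  have Int_stable: "Int_stable (range (lessThan :: real \<Rightarrow> _))"
  proof -
    have "{..<a} \<inter> {..<b} = {..<min a b}" for a b :: real by auto
    then show ?thesis unfolding Int_stable_def by auto
  qed
  have subset_Pow: "range (lessThan :: real \<Rightarrow> _) \<subseteq> Pow UNIV" by simp
  fix A :: "real set" assume "A \<in> sets lborel"
  then have "A \<in> sigma_sets UNIV (range lessThan)"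
    by (simp add: borel)
  then show "(LINT x:A|lborel. g x) = 0"
  proof (induction rule: sigma_sets_induct_disjoint[OF Int_stable subset_Pow, consumes 1, case_names basic empty compl union])
    case (compl A)
    then have A: "A \<in> sets borel" by (simp add: borel)
    have "(LINT x|lborel. g x) = (LINT x:A \<union> (UNIV - A)|lborel. g x)"
      by (simp add: set_lebesgue_integral_def)
    also have "\<dots> = (LINT x:A|lborel. g x) + (LINT x:UNIV - A|lborel. g x)"
      using A by (intro set_integral_Un int) auto
    finally show ?case using compl total by simp
  next
    case (union A)
    then have A: "A i \<in> sets borel" for i by (auto simp: borel)
    have "(LINT x:(\<Union>i. A i)|lborel. g x) = (\<Sum>i. (LINT x:A i|lborel. g x))"
      using A union by (intro lebesgue_integral_countable_add int) (auto simp: disjoint_family_on_def)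
    then show ?case using union by simp
  qed (use lessThan in \<open>auto simp: set_lebesgue_integral_def\<close>)
qed

lemma AE_zero_of_interval_integrals:
  fixes f :: "real \<Rightarrow> real"
  assumes f: "set_integrable lebesgue unit_ioo f"
    and int: "\<And>lo hi. 0 \<le> lo \<Longrightarrow> lo < hi \<Longrightarrow> hi \<le> 1 \<Longrightarrow> (LINT x:{lo<..<hi}|lebesgue. f x) = 0"
  shows "AE x in lebesgue. x \<in> unit_ioo \<longrightarrow> f x = 0"
proof -
  define h where "h = (\<lambda>x. indicator unit_ioo x *\<^sub>R f x)"
  have h: "integrable lebesgue h"
    using f by (simp add: h_def set_integrable_def)
  \<comment> \<open>The generator argument lives on Borel sets, while \<open>f\<close> is only
    Lebesgue measurable. Its truncation is therefore replaced by a Borel function equal to it almost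
    everywhere.\<close>
  obtain g where g [measurable]: "g \<in> borel_measurable lborel" and "AE x in lborel. h x = g x"
    using completion_ex_borel_measurable_real[OF borel_measurable_integrable[OF h]] by blast
  then have hg: "AE x in lebesgue. h x = g x"
    by (intro AE_completion)
  have g_lebesgue: "integrable lebesgue g"
    using integrable_cong_AE_imp[OF h _ hg] g measurable_completion by blast
  have eq: "(LINT x:A|lborel. g x) = (LINT x:A \<inter> unit_ioo|lebesgue. f x)" if A: "A \<in> sets borel" for A
  proof -
    have "(LINT x:A|lborel. g x) = (LINT x|lebesgue. indicator A x *\<^sub>R g x)"
      unfolding set_lebesgue_integral_def using A by (intro integral_completion[symmetric]) auto
    also have "\<dots> = (LINT x|lebesgue. indicator A x *\<^sub>R h x)"
    proof (rule integral_cong_AE)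
      show "(\<lambda>x. indicator A x *\<^sub>R g x) \<in> borel_measurable lebesgue"
        "(\<lambda>x. indicator A x *\<^sub>R h x) \<in> borel_measurable lebesgue"
        using g_lebesgue h A by (auto intro!: borel_measurable_integrable integrable_mult_indicator simp del: real_scaleR_def)
    qed (use hg in auto)
    also have "\<dots> = (LINT x:A \<inter> unit_ioo|lebesgue. f x)"
      by (simp add: h_def set_lebesgue_integral_def indicator_inter_arith mult.assoc)
    finally show ?thesis .
  qed
  have "AE x in lborel. g x = 0"
  proof (rule AE_zero_of_lessThan_integrals)
    show "integrable lborel g"
      using g_lebesgue integrable_completion[OF g] by simp
    have "(LINT x:UNIV|lborel. g x) = 0"
      using int[of 0 1] by (subst eq) auto
    then show "(LINT x|lborel. g x) = 0"
      by (simp add: set_lebesgue_integral_def)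
    fix t :: real
    \<comment> \<open>Since the truncation vanishes outside the unit interval, a half-line
      contributes only this interval, which is empty for \<open>t\<close> at most 0.\<close>
    have "{..<t} \<inter> unit_ioo = {0<..<min t 1}" by auto
    then have "(LINT x:{..<t}|lborel. g x) = (LINT x:{0<..<min t 1}|lebesgue. f x)"
      using eq[of "{..<t}"] by simp
    also have "\<dots> = 0"
    proof (cases "t \<le> 0")
      case True
      then have "{0<..<min t 1} = {}" by auto
      then show ?thesis by (simp only: set_lebesgue_integral_def) simp
    qed (use int[of 0 "min t 1"] in auto)
    finally show "(LINT x:{..<t}|lborel. g x) = 0" .
  qed
  then have "AE x in lebesgue. g x = 0"
    by (rule AE_completion)
  with hg show ?thesis
    by eventually_elim (auto simp: h_def)
qed

lemma test_function_continuous_on: "test_function \<phi> \<Longrightarrow> continuous_on A \<phi>"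
  by (meson smooth_continuous_on test_functionE)

text \<open>Bumps converge pointwise to the indicator of an open interval and stay between 0 and 1,
  so dominated convergence with majorant |f| turns the vanishing test integrals into vanishing
  interval integrals.\<close>

lemma fundamental_lemma:
  assumes f: "set_integrable lebesgue unit_ioo f"
    and test: "\<And>\<phi>. test_function \<phi> \<Longrightarrow> (LINT x:unit_ioo|lebesgue. f x * \<phi> x) = 0"
  shows "AE x in lebesgue. x \<in> unit_ioo \<longrightarrow> f x = 0"
proof (rule AE_zero_of_interval_integrals[OF f])
  fix lo hi :: real assume bounds: "0 \<le> lo" "lo < hi" "hi \<le> 1"
  have "(\<lambda>n. LINT x|lebesgue. indicator unit_ioo x *\<^sub>R (f x * bump lo hi n x))
      \<longlonglongrightarrow> (LINT x|lebesgue. indicator {lo<..<hi} x *\<^sub>R f x)"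
  proof (rule integral_dominated_convergence)
    show "integrable lebesgue (\<lambda>x. \<bar>indicator unit_ioo x *\<^sub>R f x\<bar>)"
      using f unfolding set_integrable_def by (rule integrable_abs)
    have "set_integrable lebesgue {lo<..<hi} f"
      using bounds by (intro set_integrable_subset[OF f]) auto
    then show "(\<lambda>x. indicator {lo<..<hi} x *\<^sub>R f x) \<in> borel_measurable lebesgue"
      unfolding set_integrable_def by auto
    show "(\<lambda>x. indicator unit_ioo x *\<^sub>R (f x * bump lo hi n x)) \<in> borel_measurable lebesgue" for n
      using set_integrable_mult_continuous[OF f smooth_continuous_on[OF smooth_bump]]
      unfolding set_integrable_def by auto
    show "AE x in lebesgue. norm (indicator unit_ioo x *\<^sub>R (f x * bump lo hi n x))
        \<le> \<bar>indicator unit_ioo x *\<^sub>R f x\<bar>" for n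
      using bump_bounds by (intro AE_I2) (auto simp: abs_mult indicator_def intro: mult_right_le_one_le)
    have "(\<lambda>n. indicator unit_ioo x *\<^sub>R (f x * bump lo hi n x))
        \<longlonglongrightarrow> indicator unit_ioo x *\<^sub>R (f x * indicator {lo<..<hi} x)" for x
      using bounds by (intro tendsto_intros bump_tendsto_indicator)
    moreover have "indicator unit_ioo x *\<^sub>R (f x * indicator {lo<..<hi} x) = indicator {lo<..<hi} x *\<^sub>R f x" for x
      using bounds by (auto simp: indicator_def)
    ultimately show "AE x in lebesgue. (\<lambda>n. indicator unit_ioo x *\<^sub>R (f x * bump lo hi n x))
        \<longlonglongrightarrow> indicator {lo<..<hi} x *\<^sub>R f x"
      by (intro AE_I2) metis
  qed
  moreover have "(LINT x|lebesgue. indicator unit_ioo x *\<^sub>R (f x * bump lo hi n x)) = 0" for n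
    using test[OF test_function_bump[OF bounds]] by (simp add: set_lebesgue_integral_def)
  ultimately show "(LINT x:{lo<..<hi}|lebesgue. f x) = 0"
    by (simp add: set_lebesgue_integral_def LIMSEQ_const_iff)
qed

section \<open>Weak derivatives\<close>

lemma LINT_continuous_eq_integral:
  fixes f :: "real \<Rightarrow> real"
  assumes "continuous_on {0..1} f"
  shows "(LINT x:unit_ioo|lebesgue. f x) = integral {0..1} f"
  using set_lebesgue_integral_eq_integral(2)[OF continuous_set_integrable[OF assms]]
  by (simp add: integral_open_interval_real)

lemma LINT_derivative:
  fixes f F :: "real \<Rightarrow> real"
  assumes "continuous_on {0..1} f"
    and "\<And>x. x \<in> {0..1} \<Longrightarrow> (F has_real_derivative f x) (at x within {0..1})"
  shows "(LINT x:unit_ioo|lebesgue. f x) = F 1 - F 0"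
  using fundamental_theorem_of_calculus[of 0 1 F f] assms
  by (simp add: LINT_continuous_eq_integral has_real_derivative_iff_has_vector_derivative integral_unique)

section \<open>Primitives, and the passage between weak and classical derivatives\<close>

definition primitive :: "(real \<Rightarrow> real) \<Rightarrow> real \<Rightarrow> real" where
  "primitive f t = integral {0..t} f"

text \<open>For negative arguments the interval of integration is empty and the primitive is 0.
  Vanishing of \<open>f\<close> to the left of a positive \<open>p\<close> makes this agree with the
  true antiderivative, so the derivative is two-sided at every real point.\<close>

lemma primitive_has_derivative:
  assumes "continuous_on UNIV f" and "0 < p" and zero: "\<And>x. x < p \<Longrightarrow> f x = 0"
  shows "(primitive f has_real_derivative f x) (at x)"
proof (cases "x < p")
  case True
  have "(primitive f has_real_derivative 0) (at x)"
  proof (rule has_field_derivative_transform_within_open[where S = "{..<p}"])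
    show "0 = primitive f t" if "t \<in> {..<p}" for t
      unfolding primitive_def using that zero by (subst integral_cong[where g = "\<lambda>_. 0"]) auto
  qed (use True in auto)
  then show ?thesis using zero True by simp
next
  case False
  have "(primitive f has_real_derivative f x) (at x within {0..x + 1})"
    unfolding primitive_def using assms False
    by (intro integral_has_real_derivative continuous_on_subset[OF assms(1)]) auto
  then show ?thesis
    using False assms(2) by (simp add: at_within_Icc_at)
qed

lemma derivative_continuous_on:
  assumes "\<And>x. x \<in> A \<Longrightarrow> (u has_real_derivative u' x) (at x within A)"
  shows "continuous_on A u"
  using assms DERIV_continuous unfolding continuous_on_eq_continuous_within by blast

text \<open>Integration by parts: the derivative of u \<phi> integrates to boundary terms, and these
  vanish because the support of \<phi> avoids 0 and 1.\<close>

lemma weak_derivative_C1: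
  assumes u: "\<And>x. x \<in> {0..1} \<Longrightarrow> (u has_real_derivative u' x) (at x within {0..1})"
    and u': "continuous_on {0..1} u'"
  shows "weak_derivative u u'"
  unfolding weak_derivative_def
proof (intro allI impI)
  fix \<phi> assume "test_function \<phi>"
  then obtain p q where \<phi>: "smooth \<phi>" "0 < p" "p < q" "q < 1" "\<And>x. x \<notin> {p..q} \<Longrightarrow> \<phi> x = 0"
    using test_functionE by blast
  note cont = derivative_continuous_on[OF u] u' smooth_continuous_on[OF \<phi>(1)]
    smooth_continuous_on[OF smooth_deriv[OF \<phi>(1)]]
  have "(LINT x:unit_ioo|lebesgue. u x * deriv \<phi> x + u' x * \<phi> x) = u 1 * \<phi> 1 - u 0 * \<phi> 0"
    using cont
    by (intro LINT_derivative[where F = "\<lambda>x. u x * \<phi> x"] DERIV_mult' u continuous_intros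
        has_field_derivative_at_within[OF smooth_has_deriv[OF \<phi>(1)]])
  also have "\<dots> = 0" using \<phi> by simp
  finally have "(LINT x:unit_ioo|lebesgue. u x * deriv \<phi> x + u' x * \<phi> x) = 0" .
  moreover have "(LINT x:unit_ioo|lebesgue. u x * deriv \<phi> x + u' x * \<phi> x) =
      (LINT x:unit_ioo|lebesgue. u x * deriv \<phi> x) + (LINT x:unit_ioo|lebesgue. u' x * \<phi> x)"
    using cont by (intro set_integral_add continuous_set_integrable continuous_intros)
  ultimately show "(LINT x:unit_ioo|lebesgue. u x * deriv \<phi> x) = - (LINT x:unit_ioo|lebesgue. u' x * \<phi> x)"
    by simp
qed

lemma continuous_square_integrable:
  assumes "continuous_on {0..1} f" shows "square_integrable f"
  unfolding square_integrable_def
  using continuous_set_integrable[OF assms] assms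
  by (auto simp: set_integrable_def set_borel_measurable_def
      intro!: continuous_set_integrable[unfolded set_integrable_def real_scaleR_def] continuous_intros)

text \<open>Makes the choice in \<open>wderiv\<close> harmless: the difference of two candidates
  integrates to zero against every test function, so the fundamental lemma applies.\<close>

lemma weak_derivative_unique:
  assumes "square_integrable v" "weak_derivative u v" "square_integrable w" "weak_derivative u w"
  shows "AE x in lebesgue. x \<in> unit_ioo \<longrightarrow> v x = w x"
proof -
  note int = square_integrable_imp_set_integrable[OF assms(1)]
    square_integrable_imp_set_integrable[OF assms(3)]
  have "AE x in lebesgue. x \<in> unit_ioo \<longrightarrow> v x - w x = 0"
  proof (rule fundamental_lemma)
    show "set_integrable lebesgue unit_ioo (\<lambda>x. v x - w x)"
      using int by (rule set_integral_diff)
    fix \<phi> assume \<phi>: "test_function \<phi>"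
    have "(LINT x:unit_ioo|lebesgue. (v x - w x) * \<phi> x) =
        (LINT x:unit_ioo|lebesgue. v x * \<phi> x) - (LINT x:unit_ioo|lebesgue. w x * \<phi> x)"
      unfolding left_diff_distrib
      by (intro set_integral_diff set_integrable_mult_continuous int test_function_continuous_on[OF \<phi>])
    also have "\<dots> = 0"
      using assms \<phi> by (simp add: weak_derivative_def)
    finally show "(LINT x:unit_ioo|lebesgue. (v x - w x) * \<phi> x) = 0" .
  qed
  then show ?thesis by simp
qed

lemma wderiv_H1:
  assumes "u \<in> H1"
  shows "square_integrable (wderiv u)" "weak_derivative u (wderiv u)"
  using someI_ex[of "\<lambda>v. square_integrable v \<and> weak_derivative u v"] assms
  by (auto simp: H1_def wderiv_def)

text \<open>Supplies the functions with which the weak formulation is tested, and identifies the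
  chosen weak derivative with the classical one.\<close>

lemma H1_C1:
  assumes u: "\<And>x. x \<in> {0..1} \<Longrightarrow> (u has_real_derivative u' x) (at x within {0..1})"
    and u': "continuous_on {0..1} u'"
  shows "u \<in> H1" "AE x in lebesgue. x \<in> unit_ioo \<longrightarrow> wderiv u x = u' x"
proof -
  show "u \<in> H1"
    unfolding H1_def
    using derivative_continuous_on[OF u] continuous_square_integrable weak_derivative_C1[OF u u'] u'
    by blast
  then show "AE x in lebesgue. x \<in> unit_ioo \<longrightarrow> wderiv u x = u' x"
    by (intro weak_derivative_unique[where u = u] wderiv_H1 weak_derivative_C1 u u' continuous_square_integrable)
qed

text \<open>Serves to exchange \<open>wderiv\<close> for an explicit representative under an
  integral. Measurability of both integrands is again obtained from truncated factors.\<close>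

lemma LINT_mult_cong_AE:
  fixes f v w :: "real \<Rightarrow> real"
  assumes "set_borel_measurable lebesgue unit_ioo f" "set_borel_measurable lebesgue unit_ioo v"
    "set_borel_measurable lebesgue unit_ioo w"
    and "AE x in lebesgue. x \<in> unit_ioo \<longrightarrow> v x = w x"
  shows "(LINT x:unit_ioo|lebesgue. f x * v x) = (LINT x:unit_ioo|lebesgue. f x * w x)"
proof -
  have "(\<lambda>x. indicator unit_ioo x *\<^sub>R (f x * g x)) =
      (\<lambda>x. (indicator unit_ioo x *\<^sub>R f x) * (indicator unit_ioo x *\<^sub>R g x))" for g :: "real \<Rightarrow> real"
    by (auto simp: indicator_def)
  then have "(\<lambda>x. indicator unit_ioo x *\<^sub>R (f x * g x)) \<in> borel_measurable lebesgue"
    if "set_borel_measurable lebesgue unit_ioo g" for g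
    using assms(1) that unfolding set_borel_measurable_def by (simp only: borel_measurable_times)
  then show ?thesis
    unfolding set_lebesgue_integral_def
    using assms by (intro integral_cong_AE) (auto simp: indicator_def)
qed

text \<open>The square of \<open>u\<close> is continuous, nonnegative and of integral zero, hence
  zero at every point of the closed interval, endpoints included.\<close>

lemma AE_zero_imp_zero:
  assumes "continuous_on {0..1} u" "AE x in lebesgue. x \<in> unit_ioo \<longrightarrow> u x = (0::real)" "x \<in> {0..1}"
  shows "u x = 0"
proof -
  have sq: "continuous_on {0..1} (\<lambda>x. (u x)\<^sup>2)"
    using assms by (intro continuous_intros)
  have "(LINT x:unit_ioo|lebesgue. (u x)\<^sup>2) = 0"
    unfolding set_lebesgue_integral_def
    by (rule integral_eq_zero_AE) (use assms(2) in \<open>auto simp: indicator_def\<close>)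
  then have "integral {0..1} (\<lambda>x. (u x)\<^sup>2) = 0"
    using LINT_continuous_eq_integral[OF sq] by simp
  then show ?thesis
    using integral_eq_0_iff[OF sq] assms(3) by simp
qed

text \<open>The primitive of a test function is again a test function precisely when its integral
  vanishes; a fixed bump of positive mass is used to correct the integral.\<close>

lemma constant_of_weak_derivative_zero:
  assumes u: "continuous_on {0..1} u"
    and weak: "\<And>\<phi>. test_function \<phi> \<Longrightarrow> (LINT x:unit_ioo|lebesgue. u x * deriv \<phi> x) = 0"
  obtains C where "\<And>x. x \<in> {0..1} \<Longrightarrow> u x = C"
proof -
  define \<eta> where "\<eta> = bump 0 1 0"
  define m where "m = (LINT x:unit_ioo|lebesgue. \<eta> x)"
  have \<eta>: "test_function \<eta>"
    unfolding \<eta>_def by (rule test_function_bump) auto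
  have "m \<noteq> 0"
  proof
    assume "m = 0"
    moreover have cont: "continuous_on {0..1} \<eta>"
      using \<eta> by (rule test_function_continuous_on)
    ultimately have "integral {0..1} \<eta> = 0"
      by (simp add: m_def LINT_continuous_eq_integral)
    then have "\<eta> (1 / 2) = 0"
      using integral_eq_0_iff[OF cont] bump_bounds(1) by (auto simp: \<eta>_def)
    then show False
      using bump_pos[of 0 1 0] by (simp add: \<eta>_def)
  qed
  \<comment> \<open>The only possible constant: if u = C, then integrating u \<eta> gives C times
    the mass of \<eta>.\<close>
  define C where "C = (LINT x:unit_ioo|lebesgue. u x * \<eta> x) / m"
  have "AE x in lebesgue. x \<in> unit_ioo \<longrightarrow> u x - C = 0"
  proof (rule fundamental_lemma)
    show "set_integrable lebesgue unit_ioo (\<lambda>x. u x - C)"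
      using u by (intro continuous_set_integrable continuous_intros)
    fix \<psi> assume \<psi>: "test_function \<psi>"
    \<comment> \<open>The ratio of the masses of \<psi> and \<eta>, so that \<theta> has integral
      zero. Once its primitive is known to be a test function, u \<theta> integrates to 0, which
      says exactly that (u - C) \<psi> integrates to 0.\<close>
    define k where "k = (LINT x:unit_ioo|lebesgue. \<psi> x) / m"
    define \<theta> where "\<theta> x = \<psi> x + (- k) * \<eta> x" for x
    obtain p\<^sub>1 q\<^sub>1 where \<psi>': "smooth \<psi>" "0 < p\<^sub>1" "q\<^sub>1 < 1" "\<And>x. x \<notin> {p\<^sub>1..q\<^sub>1} \<Longrightarrow> \<psi> x = 0"
      using test_functionE[OF \<psi>] by metis
    obtain p\<^sub>2 q\<^sub>2 where \<eta>': "smooth \<eta>" "0 < p\<^sub>2" "q\<^sub>2 < 1" "\<And>x. x \<notin> {p\<^sub>2..q\<^sub>2} \<Longrightarrow> \<eta> x = 0"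
      using test_functionE[OF \<eta>] by metis
    define p where "p = min p\<^sub>1 p\<^sub>2"
    \<comment> \<open>Halfway between 1 and the larger of 0 and both right ends: positive, below 1,
      and strictly to the right of both supports, so that \<theta> vanishes at \<open>q\<close> as
      well.\<close>
    define q where "q = (max (max q\<^sub>1 q\<^sub>2) 0 + 1) / 2"
    have pq: "0 < p" "q < 1" "q\<^sub>1 < q" "q\<^sub>2 < q" "0 < q"
      using \<psi>'(2,3) \<eta>'(2,3) by (auto simp: p_def q_def max_def)
    have \<theta>_left: "\<theta> x = 0" if "x < p" for x
      using that \<psi>'(4)[of x] \<eta>'(4)[of x] by (auto simp: \<theta>_def p_def)
    have \<theta>_right: "\<theta> x = 0" if "q \<le> x" for x
      using that pq(3,4) \<psi>'(4)[of x] \<eta>'(4)[of x] by (auto simp: \<theta>_def)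
    have "smooth \<theta>"
      unfolding \<theta>_def by (intro smooth_add smooth_cmult \<psi>'(1) \<eta>'(1))
    note \<theta>_cont = smooth_continuous_on[OF this]
    note cont = u test_function_continuous_on[OF \<psi>] test_function_continuous_on[OF \<eta>]
    have der: "(primitive \<theta> has_real_derivative \<theta> x) (at x)" for x
      by (rule primitive_has_derivative[OF \<theta>_cont pq(1) \<theta>_left])
    have "(LINT x:unit_ioo|lebesgue. \<theta> x) =
        (LINT x:unit_ioo|lebesgue. \<psi> x) + (LINT x:unit_ioo|lebesgue. (- k) * \<eta> x)"
      unfolding \<theta>_def using cont by (intro set_integral_add continuous_set_integrable continuous_intros)
    also have "\<dots> = 0"
      unfolding set_integral_mult_right m_def[symmetric] using \<open>m \<noteq> 0\<close> by (simp add: k_def)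
    finally have total: "integral {0..1} \<theta> = 0"
      by (simp add: LINT_continuous_eq_integral \<theta>_cont)
    \<comment> \<open>To the right of the supports the primitive is constant; its value there is the
      total integral of \<theta>, namely 0. This gives compact support.\<close>
    have tail: "primitive \<theta> t = primitive \<theta> q" if "q \<le> t" for t
    proof -
      have "integral {0..q} \<theta> + integral {q..t} \<theta> = integral {0..t} \<theta>"
        using that pq by (intro Henstock_Kurzweil_Integration.integral_combine integrable_continuous_real \<theta>_cont) auto
      moreover have "integral {q..t} \<theta> = 0"
        using \<theta>_right by (subst integral_cong[where g = "\<lambda>_. 0"]) auto
      ultimately show ?thesis by (simp add: primitive_def)
    qed
    have "primitive \<theta> q = primitive \<theta> 1"
      using pq by (intro tail[symmetric]) simp
    then have "primitive \<theta> q = 0"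
      by (simp add: primitive_def total)
    then have "test_function (primitive \<theta>)"
    proof (intro test_functionI[OF smooth_primitive[OF der \<open>smooth \<theta>\<close>] pq(1,2)])
      fix x assume "primitive \<theta> q = 0" "x \<notin> {p..q}"
      moreover have "primitive \<theta> x = 0" if "x < p"
        unfolding primitive_def using that \<theta>_left by (subst integral_cong[where g = "\<lambda>_. 0"]) auto
      ultimately show "primitive \<theta> x = 0"
        using tail[of x] by auto
    qed
    then have "(LINT x:unit_ioo|lebesgue. u x * \<theta> x) = 0"
      using weak[of "primitive \<theta>"] DERIV_imp_deriv[OF der] by simp
    moreover have "(LINT x:unit_ioo|lebesgue. u x * \<theta> x) =
        (LINT x:unit_ioo|lebesgue. u x * \<psi> x) + (- k) * (LINT x:unit_ioo|lebesgue. u x * \<eta> x)"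
    proof -
      have "(\<lambda>x. u x * \<theta> x) = (\<lambda>x. u x * \<psi> x + (- k) * (u x * \<eta> x))"
        by (simp add: \<theta>_def fun_eq_iff algebra_simps)
      moreover have "(LINT x:unit_ioo|lebesgue. u x * \<psi> x + (- k) * (u x * \<eta> x)) =
          (LINT x:unit_ioo|lebesgue. u x * \<psi> x) + (LINT x:unit_ioo|lebesgue. (- k) * (u x * \<eta> x))"
        using cont by (intro set_integral_add continuous_set_integrable continuous_intros)
      ultimately show ?thesis
        by (simp only: set_integral_mult_right)
    qed
    moreover have "(LINT x:unit_ioo|lebesgue. (u x - C) * \<psi> x) =
        (LINT x:unit_ioo|lebesgue. u x * \<psi> x) - (LINT x:unit_ioo|lebesgue. C * \<psi> x)"
      unfolding left_diff_distrib
      using cont by (intro set_integral_diff continuous_set_integrable continuous_intros)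
    ultimately show "(LINT x:unit_ioo|lebesgue. (u x - C) * \<psi> x) = 0"
      by (simp add: k_def C_def)
  qed
  then have "u x = C" if "x \<in> {0..1}" for x
    using AE_zero_imp_zero[OF continuous_on_diff[OF u continuous_on_const] _ that, of C] by simp
  then show ?thesis using that by blast
qed

text \<open>Regularity: subtracting from \<open>u\<close> the primitive of the continuous
  representative leaves a continuous function with weak derivative zero, hence a constant. The
  derivative is one-sided at the endpoints.\<close>

lemma has_derivative_of_wderiv:
  assumes u: "u \<in> H1" and w: "continuous_on {0..1} w"
    and ae: "AE x in lebesgue. x \<in> unit_ioo \<longrightarrow> wderiv u x = w x" and x: "x \<in> {0..1}"
  shows "(u has_real_derivative w x) (at x within {0..1})"
proof -
  define W where "W = primitive w"
  have W: "(W has_real_derivative w x) (at x within {0..1})" if "x \<in> {0..1}" for x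
    unfolding W_def primitive_def using integral_has_real_derivative[OF w that] .
  note cont = derivative_continuous_on[OF W]
  have u_cont: "continuous_on {0..1} u" using u by (simp add: H1_def)
  obtain C where C: "\<And>x. x \<in> {0..1} \<Longrightarrow> u x - W x = C"
  proof (rule constant_of_weak_derivative_zero)
    show "continuous_on {0..1} (\<lambda>x. u x - W x)"
      using cont u_cont by (intro continuous_intros)
    fix \<phi> assume \<phi>: "test_function \<phi>"
    then have d\<phi>: "continuous_on {0..1} (deriv \<phi>)"
      using smooth_continuous_on smooth_deriv test_functionE by metis
    have \<phi>_cont: "continuous_on {0..1} \<phi>" using \<phi> by (rule test_function_continuous_on)
    have "(LINT x:unit_ioo|lebesgue. (u x - W x) * deriv \<phi> x) =
        (LINT x:unit_ioo|lebesgue. u x * deriv \<phi> x) - (LINT x:unit_ioo|lebesgue. W x * deriv \<phi> x)"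
      unfolding left_diff_distrib
      using cont d\<phi> u_cont by (intro set_integral_diff continuous_set_integrable continuous_intros)
    also have "\<dots> = - (LINT x:unit_ioo|lebesgue. \<phi> x * wderiv u x) + (LINT x:unit_ioo|lebesgue. \<phi> x * w x)"
      using wderiv_H1(2)[OF u] weak_derivative_C1[OF W w] \<phi> by (simp add: weak_derivative_def mult.commute)
    also have "(LINT x:unit_ioo|lebesgue. \<phi> x * wderiv u x) = (LINT x:unit_ioo|lebesgue. \<phi> x * w x)"
      using wderiv_H1(1)[OF u] continuous_square_integrable[OF w] continuous_square_integrable[OF \<phi>_cont] ae
      by (intro LINT_mult_cong_AE) (auto simp: square_integrable_def)
    finally show "(LINT x:unit_ioo|lebesgue. (u x - W x) * deriv \<phi> x) = 0" by simp
  qed (use that in blast)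
  have "((\<lambda>x. W x + C) has_real_derivative w x) (at x within {0..1})"
    using DERIV_add[OF W[OF x] DERIV_const] by simp
  then show ?thesis
    by (rule has_field_derivative_transform_within[OF _ zero_less_one x])
      (use C in \<open>auto simp: algebra_simps\<close>)
qed

section \<open>The flux and the stationary ODE\<close>

lemma weak_solution_flux:
  assumes sol: "weak_solution \<epsilon> \<alpha> \<beta> \<rho>"
  shows "\<alpha> * (1 - \<rho> 0) = \<beta> * \<rho> 1"
    and "AE x in lebesgue. x \<in> unit_ioo \<longrightarrow> flux \<epsilon> \<rho> x = \<beta> * \<rho> 1"
proof -
  have \<rho>: "\<rho> \<in> H1" using sol by (simp add: weak_solution_def)
  then have \<rho>_cont: "continuous_on {0..1} \<rho>" by (simp add: H1_def)
  define f where "f x = \<epsilon> * wderiv \<rho> x - \<rho> x * (1 - \<rho> x)" for x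
  have f: "set_integrable lebesgue unit_ioo f"
    unfolding f_def
    by (rule set_integral_diff[OF set_integrable_mult_right[OF
          square_integrable_imp_set_integrable[OF wderiv_H1(1)[OF \<rho>]]] continuous_set_integrable])
      (intro continuous_intros \<rho>_cont)
  \<comment> \<open>The weak formulation for continuously differentiable \<phi>, with the classical
    derivative in place of \<open>wderiv \<phi>\<close>.\<close>
  have tested: "(LINT x:unit_ioo|lebesgue. f x * \<phi>' x) - \<alpha> * (1 - \<rho> 0) * \<phi> 0 + \<beta> * \<rho> 1 * \<phi> 1 = 0"
    if \<phi>: "\<And>x. (\<phi> has_real_derivative \<phi>' x) (at x)" and \<phi>': "continuous_on {0..1} \<phi>'" for \<phi> \<phi>'
  proof -
    have \<phi>_H1: "\<phi> \<in> H1" and ae: "AE x in lebesgue. x \<in> unit_ioo \<longrightarrow> wderiv \<phi> x = \<phi>' x"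
      using H1_C1[OF has_field_derivative_at_within[OF \<phi>] \<phi>'] by auto
    have "(LINT x:unit_ioo|lebesgue. f x * wderiv \<phi> x) = (LINT x:unit_ioo|lebesgue. f x * \<phi>' x)"
      using f wderiv_H1(1)[OF \<phi>_H1] continuous_square_integrable[OF \<phi>'] ae
      by (intro LINT_mult_cong_AE)
        (auto simp: square_integrable_def set_integrable_def set_borel_measurable_def)
    moreover have "(LINT x:unit_ioo|lebesgue. f x * wderiv \<phi> x)
        - \<alpha> * (1 - \<rho> 0) * \<phi> 0 + \<beta> * \<rho> 1 * \<phi> 1 = 0"
      using sol \<phi>_H1 by (auto simp: weak_solution_def f_def)
    ultimately show ?thesis by simp
  qed
  \<comment> \<open>The constant test function 1 has derivative 0, so only the two boundary terms
    survive.\<close>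
  show "\<alpha> * (1 - \<rho> 0) = \<beta> * \<rho> 1"
    using tested[of "\<lambda>_. 1" "\<lambda>_. 0"] by simp
  have "AE x in lebesgue. x \<in> unit_ioo \<longrightarrow> f x + \<beta> * \<rho> 1 = 0"
  proof (rule fundamental_lemma)
    show "set_integrable lebesgue unit_ioo (\<lambda>x. f x + \<beta> * \<rho> 1)"
      by (intro set_integral_add f continuous_set_integrable continuous_intros)
    fix \<psi> assume \<psi>: "test_function \<psi>"
    then obtain p where p: "0 < p" "\<And>x. x < p \<Longrightarrow> \<psi> x = 0"
      by (rule test_functionE) auto
    note cont = test_function_continuous_on[OF \<psi>]
    have "(LINT x:unit_ioo|lebesgue. (f x + \<beta> * \<rho> 1) * \<psi> x) =
        (LINT x:unit_ioo|lebesgue. f x * \<psi> x) + (LINT x:unit_ioo|lebesgue. \<beta> * \<rho> 1 * \<psi> x)"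
      unfolding distrib_right
      by (intro set_integral_add set_integrable_mult_continuous continuous_set_integrable f cont continuous_intros)
    \<comment> \<open>The weak form is tested with the primitive of \<psi>. It vanishes at 0, which
      removes the left boundary term, and its value at 1 is the integral of \<psi>, so the right
      boundary term merges with the integral. Since f is the negative of the flux, this identifies
      the constant.\<close>
    also have "(LINT x:unit_ioo|lebesgue. \<beta> * \<rho> 1 * \<psi> x) = \<beta> * \<rho> 1 * primitive \<psi> 1"
      by (simp add: LINT_continuous_eq_integral cont primitive_def)
    finally show "(LINT x:unit_ioo|lebesgue. (f x + \<beta> * \<rho> 1) * \<psi> x) = 0"
      using tested[OF primitive_has_derivative[OF cont p] cont] by (simp add: primitive_def)
  qed
  then show "AE x in lebesgue. x \<in> unit_ioo \<longrightarrow> flux \<epsilon> \<rho> x = \<beta> * \<rho> 1"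
    by eventually_elim (auto simp: f_def flux_def)
qed

section \<open>Estimates from the stationary ODE\<close>

lemma flux_ge_quarter:
  fixes \<rho> :: "real \<Rightarrow> real"
  assumes "\<epsilon> > 0"
    and ode: "\<And>x. x \<in> {0..1} \<Longrightarrow> (\<rho> has_real_derivative (\<rho> x * (1 - \<rho> x) - j) / \<epsilon>) (at x within {0..1})"
    and left: "\<rho> 0 > 1/2" and right: "\<rho> 1 < 1/2"
  shows "j \<ge> 1/4"
proof (rule ccontr)
  assume j: "\<not> j \<ge> 1/4"
  have cont: "continuous_on {0..1} \<rho>"
    by (rule derivative_continuous_on[OF ode])
  define S where "S = {0..1} \<inter> \<rho> -` {1/2}"
  have "compact S"
    unfolding S_def compact_eq_bounded_closed
    by (auto intro: bounded_subset[OF bounded_closed_interval] continuous_closed_preimage[OF cont])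
  obtain y where "0 \<le> y" "y \<le> 1" "\<rho> y = 1/2"
    using IVT2'[of \<rho> 1 "1/2" 0] left right cont by auto
  then have "S \<noteq> {}" by (auto simp: S_def)
  \<comment> \<open>The first time at which \<rho> takes the value 1/2. There the ODE gives the
    slope (1/4 - j)/\<epsilon>, which is positive, so \<rho> is below 1/2 just before
    \<open>t\<close>.\<close>
  obtain t where t: "t \<in> S" "\<And>s. s \<in> S \<Longrightarrow> t \<le> s"
    using compact_attains_inf[OF \<open>compact S\<close> \<open>S \<noteq> {}\<close>] by blast
  then have t': "t \<in> {0..1}" "\<rho> t = 1/2" "0 < t"
    using left by (auto simp: S_def less_le)
  have "(\<rho> has_real_derivative (1/4 - j) / \<epsilon>) (at t within {0..1})"
    using ode[OF t'(1)] t'(2) by simp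
  then obtain d where d: "d > 0" "\<And>h. h > 0 \<Longrightarrow> t - h \<in> {0..1} \<Longrightarrow> h < d \<Longrightarrow> \<rho> (t - h) < \<rho> t"
    using has_real_derivative_pos_inc_left[of \<rho> "(1/4 - j) / \<epsilon>" t "{0..1}"] j \<open>\<epsilon> > 0\<close> by auto
  define h where "h = min (d / 2) (t / 2)"
  have h: "0 < h" "h < d" "h < t" using d t' by (auto simp: h_def)
  then have "\<rho> (t - h) < 1/2" using d(2)[of h] t' by auto
  moreover have "continuous_on {0..t - h} \<rho>"
    using h t'(1) by (intro continuous_on_subset[OF cont]) auto
  \<comment> \<open>Starting above 1/2 and being below it at t - h, \<rho> must cross 1/2 before
    \<open>t\<close>, against minimality.\<close>
  ultimately obtain s where s: "0 \<le> s" "s \<le> t - h" "\<rho> s = 1/2"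
    using IVT2'[of \<rho> "t - h" "1/2" 0] left h by auto
  then have "s \<in> S" using h t' by (auto simp: S_def)
  then show False using t(2)[of s] s(2) h(1) by simp
qed

text \<open>Completing the square in the ODE gives (\<rho> - 1/2)^2 = 1/4 - j - \<epsilon> \<rho>',
  so the integrand has the explicit antiderivative (1/4 - j) x - \<epsilon> \<rho>.\<close>

lemma LINT_energy:
  fixes \<rho> :: "real \<Rightarrow> real"
  assumes "\<epsilon> > 0"
    and ode: "\<And>x. x \<in> {0..1} \<Longrightarrow> (\<rho> has_real_derivative (\<rho> x * (1 - \<rho> x) - j) / \<epsilon>) (at x within {0..1})"
  shows "(LINT x:unit_ioo|lebesgue. (\<rho> x - 1/2)\<^sup>2) = 1/4 - j + \<epsilon> * (\<rho> 0 - \<rho> 1)"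
proof -
  have "((\<lambda>x. (1/4 - j) * x - \<epsilon> * \<rho> x) has_real_derivative (\<rho> x - 1/2)\<^sup>2) (at x within {0..1})"
    if "x \<in> {0..1}" for x
  proof (rule DERIV_cong)
    show "((\<lambda>x. (1/4 - j) * x - \<epsilon> * \<rho> x) has_real_derivative
        (1/4 - j) * 1 - \<epsilon> * ((\<rho> x * (1 - \<rho> x) - j) / \<epsilon>)) (at x within {0..1})"
      by (intro DERIV_diff DERIV_cmult ode that DERIV_ident)
    have "\<epsilon> * ((\<rho> x * (1 - \<rho> x) - j) / \<epsilon>) = \<rho> x * (1 - \<rho> x) - j"
      using \<open>\<epsilon> > 0\<close> by simp
    then show "(1/4 - j) * 1 - \<epsilon> * ((\<rho> x * (1 - \<rho> x) - j) / \<epsilon>) = (\<rho> x - 1/2)\<^sup>2"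
      by (simp add: power2_eq_square algebra_simps)
  qed
  then have "(LINT x:unit_ioo|lebesgue. (\<rho> x - 1/2)\<^sup>2) =
      ((1/4 - j) * 1 - \<epsilon> * \<rho> 1) - ((1/4 - j) * 0 - \<epsilon> * \<rho> 0)"
    using derivative_continuous_on[OF ode]
    by (intro LINT_derivative[where F = "\<lambda>x. (1/4 - j) * x - \<epsilon> * \<rho> x"] continuous_intros) auto
  then show ?thesis by (simp add: algebra_simps)
qed

text \<open>Since a (1 - a) never exceeds 1/4, it is at most j = a y, and a > 0 cancels. Applied at
  each end of the interval, this turns the lower bound on the flux into a bound on the boundary
  value.\<close>

lemma one_minus_le_quotient:
  fixes a y j :: real
  assumes "a > 0" "a * y = j" "j \<ge> 1/4"
  shows "1 - a \<le> y"
proof -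
  have "a * (1 - a) \<le> 1/4"
    using zero_le_power2[of "a - 1/2"] by (simp add: power2_eq_square algebra_simps)
  then have "a * (1 - a) \<le> a * y" using assms by simp
  then show ?thesis using \<open>a > 0\<close> by simp
qed

theorem theorem4p3:
  fixes \<epsilon> \<alpha> \<beta> :: real and \<rho> :: "real \<Rightarrow> real"
  assumes "\<epsilon> > 0"
    and "\<alpha> \<in> {0..1}" and "\<beta> \<in> {0..1}"
    and "min \<alpha> \<beta> \<ge> 1/2"
    and "weak_solution \<epsilon> \<alpha> \<beta> \<rho>"
  shows "(LINT x:unit_ioo|lebesgue. (\<rho> x - 1/2)\<^sup>2) \<le> \<epsilon> * \<bar>1 - \<alpha> - \<beta>\<bar> \<and>
         (\<exists>j. (AE x in lebesgue. x \<in> unit_ioo \<longrightarrow> flux \<epsilon> \<rho> x = j) \<and> j \<ge> 1/4)"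
proof -
  define j where "j = \<beta> * \<rho> 1"
  have \<alpha>: "\<alpha> \<ge> 1/2" and \<beta>: "\<beta> \<ge> 1/2" using assms(4) by auto
  have left: "\<alpha> * (1 - \<rho> 0) = j"
    and flux: "AE x in lebesgue. x \<in> unit_ioo \<longrightarrow> flux \<epsilon> \<rho> x = j"
    using weak_solution_flux[OF assms(5)] by (simp_all add: j_def)
  have \<rho>: "\<rho> \<in> H1" using assms(5) by (simp add: weak_solution_def)
  have ode: "(\<rho> has_real_derivative (\<rho> x * (1 - \<rho> x) - j) / \<epsilon>) (at x within {0..1})"
    if "x \<in> {0..1}" for x
  proof (rule has_derivative_of_wderiv[OF \<rho> _ _ that])
    show "continuous_on {0..1} (\<lambda>x. (\<rho> x * (1 - \<rho> x) - j) / \<epsilon>)"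
      using \<rho> \<open>\<epsilon> > 0\<close> by (auto simp: H1_def intro!: continuous_intros)
    show "AE x in lebesgue. x \<in> unit_ioo \<longrightarrow> wderiv \<rho> x = (\<rho> x * (1 - \<rho> x) - j) / \<epsilon>"
      using flux by eventually_elim (use \<open>\<epsilon> > 0\<close> in \<open>auto simp: flux_def field_simps\<close>)
  qed
  have j: "j \<ge> 1/4"
  proof (rule ccontr)
    assume j: "\<not> j \<ge> 1/4"
    \<comment> \<open>Otherwise both factors of \<alpha> (1 - \<rho>(0)) = j are at least 1/2, so
      their product is at least 1/4. The bound on \<rho>(1) is symmetric.\<close>
    have "\<rho> 0 > 1/2"
      using mult_mono[OF \<alpha>, of "1/2" "1 - \<rho> 0"] left j \<alpha> by (cases "\<rho> 0 > 1/2") auto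
    moreover have "\<rho> 1 < 1/2"
      using mult_mono[OF \<beta>, of "1/2" "\<rho> 1"] j \<beta> by (cases "\<rho> 1 < 1/2") (auto simp: j_def)
    ultimately show False
      using flux_ge_quarter[OF \<open>\<epsilon> > 0\<close> ode] j by blast
  qed
  have "1 - \<alpha> \<le> 1 - \<rho> 0" "1 - \<beta> \<le> \<rho> 1"
    using \<alpha> \<beta> j by (intro one_minus_le_quotient[OF _ left] one_minus_le_quotient[OF _ j_def[symmetric]]; linarith)+
  then have "\<rho> 0 - \<rho> 1 \<le> \<bar>1 - \<alpha> - \<beta>\<bar>" by linarith
  then have "\<epsilon> * (\<rho> 0 - \<rho> 1) \<le> \<epsilon> * \<bar>1 - \<alpha> - \<beta>\<bar>"
    using \<open>\<epsilon> > 0\<close> by (intro mult_left_mono) auto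
  \<comment> \<open>In the energy identity the term 1/4 - j is nonpositive and is dropped.\<close>
  then show ?thesis
    using LINT_energy[OF \<open>\<epsilon> > 0\<close> ode] flux j by auto
qed

end
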